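(* Let $F$ be a field, $V$ a non-zero finite dimensional $F$-vector space, and $f:V\times V\to F$ a non-degenerate bilinear form whose asymmetry $\sigma$ has minimal polynomial $p^r$, where $p=X-1$ or $p=X+1$, and $r\geq 1$. View $V$ as an $F[X]$-module with $X$ acting as $\sigma$. Suppose $f$ is indecomposable. Then: (i) $V$ is a free $F[X]/(p^m)$-module for some $m\geq 1$. (ii) $\sigma$ has one elementary divisor if and only if $\widehat{f}$ is non-alternating. (iii) $\sigma$ has two elementary divisors if and only if $\widehat{f}$ is alternating. Here $\widehat{f}$ is the bilinear form on $V/pV$ given by $\widehat{f}(u+pV,v+pV)=f(p^{m-1}u,v)$ for $u,v\in V$, with $m$ as in (i).
   Context: A bilinear form on a finite dimensional space is non-degenerate if its Gram matrices are invertible. If $f$ is non-degenerate, its asymmetry is the unique $\sigma\in\mathrm{GL}(V)$ with $f(v,u)=f(u,\sigma v)$ for all $u,v\in V$. Write $V=U_1\perp U_2$ if $V=U_1\oplus U_2$ and $f(U_1,U_2)=0=f(U_2,U_1)$; $f$ is indecomposable if $V=U_1\perp U_2$ only when $U_1=0$ or $U_2=0$. Elementary divisors of $\sigma$ are those of the $F[X]$-module $V$, counted with multiplicity. When $V$ is a free $F[X]/(p^m)$-module, the form $\widehat{f}$ is well defined and non-degenerate. A bilinear form $h$ is alternating if $h(u,u)=0$ for all $u$. *)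

theory Defs
  imports
    "HOL-Computational_Algebra.Computational_Algebra"
    "HOL-Library.Multiset"
    "Jordan_Normal_Form.Matrix"
begin

section \<open>Bilinear forms\<close>

definition bilinear_form ::
    "('a::field \<Rightarrow> 'v::ab_group_add \<Rightarrow> 'v) \<Rightarrow> ('v \<Rightarrow> 'v \<Rightarrow> 'a) \<Rightarrow> bool" where
  "bilinear_form scale f \<longleftrightarrow>
     (\<forall>u. Vector_Spaces.linear scale (*) (\<lambda>v. f u v)) \<and>
     (\<forall>v. Vector_Spaces.linear scale (*) (\<lambda>u. f u v))"

definition gram_matrix :: "('v \<Rightarrow> 'v \<Rightarrow> 'a) \<Rightarrow> 'v list \<Rightarrow> 'a mat" where
  "gram_matrix f bs = mat (length bs) (length bs) (\<lambda>(i, j). f (bs ! i) (bs ! j))"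

definition nondegenerate ::
    "('a::field \<Rightarrow> 'v::ab_group_add \<Rightarrow> 'v) \<Rightarrow> ('v \<Rightarrow> 'v \<Rightarrow> 'a) \<Rightarrow> bool" where
  "nondegenerate scale f \<longleftrightarrow>
     (\<forall>bs. distinct bs \<and> \<not> Modules.module.dependent scale (set bs) \<and>
           Modules.module.span scale (set bs) = UNIV
           \<longrightarrow> invertible_mat (gram_matrix f bs))"

definition is_asymmetry ::
    "('a::field \<Rightarrow> 'v::ab_group_add \<Rightarrow> 'v) \<Rightarrow> ('v \<Rightarrow> 'v \<Rightarrow> 'a) \<Rightarrow> ('v \<Rightarrow> 'v) \<Rightarrow> bool" where
  "is_asymmetry scale f \<sigma> \<longleftrightarrow>
     Vector_Spaces.linear scale scale \<sigma> \<and> bij \<sigma> \<and> (\<forall>u v. f v u = f u (\<sigma> v))"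

definition orthogonal_decomposition ::
    "('a::field \<Rightarrow> 'v::ab_group_add \<Rightarrow> 'v) \<Rightarrow> ('v \<Rightarrow> 'v \<Rightarrow> 'a) \<Rightarrow> 'v set \<Rightarrow> 'v set \<Rightarrow> bool" where
  "orthogonal_decomposition scale f U1 U2 \<longleftrightarrow>
     Modules.module.subspace scale U1 \<and> Modules.module.subspace scale U2 \<and>
     U1 \<inter> U2 = {0} \<and> {u1 + u2 | u1 u2. u1 \<in> U1 \<and> u2 \<in> U2} = UNIV \<and>
     (\<forall>u1\<in>U1. \<forall>u2\<in>U2. f u1 u2 = 0 \<and> f u2 u1 = 0)"

definition indecomposable ::
    "('a::field \<Rightarrow> 'v::ab_group_add \<Rightarrow> 'v) \<Rightarrow> ('v \<Rightarrow> 'v \<Rightarrow> 'a) \<Rightarrow> bool" where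
  "indecomposable scale f \<longleftrightarrow>
     (\<forall>U1 U2. orthogonal_decomposition scale f U1 U2 \<longrightarrow> U1 = {0} \<or> U2 = {0})"

definition alternating_on :: "'c set \<Rightarrow> ('c \<Rightarrow> 'c \<Rightarrow> 'a::zero) \<Rightarrow> bool" where
  "alternating_on W h \<longleftrightarrow> (\<forall>u\<in>W. h u u = 0)"


section \<open>The polynomial module given by an endomorphism\<close>

text \<open>The scalar multiplication of \<open>V\<close> as a module over \<open>F[X]\<close>, with \<open>X\<close> acting as \<open>\<sigma>\<close>.\<close>

definition poly_act ::
    "('a::field \<Rightarrow> 'v::ab_group_add \<Rightarrow> 'v) \<Rightarrow> ('v \<Rightarrow> 'v) \<Rightarrow> 'a poly \<Rightarrow> 'v \<Rightarrow> 'v" where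
  "poly_act scale \<sigma> q v = (\<Sum>i\<le>Polynomial.degree q. scale (coeff q i) ((\<sigma> ^^ i) v))"

lemma poly_act_pCons:
  assumes "Vector_Spaces.linear scale scale \<sigma>"
  shows "poly_act scale \<sigma> (pCons a q) v = scale a v + \<sigma> (poly_act scale \<sigma> q v)"
proof -
  interpret l: Vector_Spaces.linear scale scale \<sigma> by fact
  have ext: "poly_act scale \<sigma> q' v = (\<Sum>i\<le>n. scale (coeff q' i) ((\<sigma> ^^ i) v))"
    if "Polynomial.degree q' \<le> n" for q' n
    unfolding poly_act_def using that
    by (intro sum.mono_neutral_left) (auto simp: coeff_eq_0)
  have "poly_act scale \<sigma> (pCons a q) v =
      (\<Sum>i\<le>Suc (Polynomial.degree q). scale (coeff (pCons a q) i) ((\<sigma> ^^ i) v))"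
    by (rule ext) (simp add: degree_pCons_le)
  also have "\<dots> = scale a v + (\<Sum>i\<le>Polynomial.degree q. scale (coeff q i) (\<sigma> ((\<sigma> ^^ i) v)))"
    by (subst sum.atMost_Suc_shift) simp
  also have "(\<Sum>i\<le>Polynomial.degree q. scale (coeff q i) (\<sigma> ((\<sigma> ^^ i) v)))
      = \<sigma> (poly_act scale \<sigma> q v)"
    by (simp add: poly_act_def l.sum l.scale)
  finally show ?thesis .
qed

lemma module_poly_act:
  assumes "Vector_Spaces.linear scale scale \<sigma>"
  shows "Modules.module (poly_act scale \<sigma>)"
proof -
  interpret l: Vector_Spaces.linear scale scale \<sigma> by fact
  note pCons = poly_act_pCons[OF assms]
  have zero: "poly_act scale \<sigma> 0 v = 0" for v
    by (simp add: poly_act_def)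
  have add_vec: "poly_act scale \<sigma> q (u + v) = poly_act scale \<sigma> q u + poly_act scale \<sigma> q v"
    for q u v
    by (induction q) (simp_all add: zero pCons l.add l.vs1.scale_right_distrib)
  have add_poly: "poly_act scale \<sigma> (q + q') v = poly_act scale \<sigma> q v + poly_act scale \<sigma> q' v"
    for q q' v
    by (induction q q' rule: poly_induct2)
       (simp_all add: zero pCons l.add l.vs1.scale_left_distrib)
  have smult: "poly_act scale \<sigma> (Polynomial.smult a q) v = scale a (poly_act scale \<sigma> q v)"
    for a q v
    by (induction q) (simp_all add: zero pCons l.scale l.vs1.scale_right_distrib)
  have mult: "poly_act scale \<sigma> (q * q') v = poly_act scale \<sigma> q (poly_act scale \<sigma> q' v)"
    for q q' v
    by (induction q) (simp_all add: zero pCons add_poly smult)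
  show ?thesis
    by unfold_locales (simp_all add: add_vec add_poly mult one_pCons pCons zero)
qed

definition is_minimal_polynomial ::
    "('a::field \<Rightarrow> 'v::ab_group_add \<Rightarrow> 'v) \<Rightarrow> ('v \<Rightarrow> 'v) \<Rightarrow> 'a poly \<Rightarrow> bool" where
  "is_minimal_polynomial scale \<sigma> q \<longleftrightarrow>
     lead_coeff q = 1 \<and> (\<forall>v. poly_act scale \<sigma> q v = 0) \<and>
     (\<forall>q'. (\<forall>v. poly_act scale \<sigma> q' v = 0) \<longrightarrow> q dvd q')"

text \<open>
  \<open>V\<close> is a free module over \<open>F[X]/(q)\<close>: the ideal \<open>(q)\<close> annihilates \<open>V\<close>, so that
  \<open>F[X]/(q)\<close> acts on \<open>V\<close>, and \<open>V\<close> has a basis for this action. Scalars in \<open>F[X]/(q)\<close>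
  are given by representatives in \<open>F[X]\<close>; such a scalar vanishes iff its representative
  is divisible by \<open>q\<close>.
\<close>

definition free_quotient_module ::
    "('a::field \<Rightarrow> 'v::ab_group_add \<Rightarrow> 'v) \<Rightarrow> ('v \<Rightarrow> 'v) \<Rightarrow> 'a poly \<Rightarrow> bool" where
  "free_quotient_module scale \<sigma> q \<longleftrightarrow>
     (\<forall>v. poly_act scale \<sigma> q v = 0) \<and>
     (\<exists>B. Modules.module.span (poly_act scale \<sigma>) B = UNIV \<and>
          (\<forall>S c. finite S \<and> S \<subseteq> B \<and> (\<Sum>b\<in>S. poly_act scale \<sigma> (c b) b) = 0
                 \<longrightarrow> (\<forall>b\<in>S. q dvd c b)))"

text \<open>
  The multiset \<open>E\<close> consists of powers \<open>d\<^sub>1, \<dots>, d\<^sub>n\<close> of monic irreducible polynomials with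
  positive exponents, and \<open>V\<close> is isomorphic to the direct sum of the \<open>F[X]/(d\<^sub>i)\<close>. The
  isomorphism is induced by a surjection from the free \<open>F[X]\<close>-module of rank \<open>n\<close> to \<open>V\<close>,
  sending the \<open>i\<close>-th unit vector to \<open>vs ! i\<close>, whose kernel is the direct sum of the ideals
  \<open>(d\<^sub>i)\<close>. By the structure theorem for modules over \<open>F[X]\<close>, there is exactly one such \<open>E\<close>
  if \<open>V\<close> is finite dimensional.
\<close>

definition elementary_divisors ::
    "('a::field \<Rightarrow> 'v::ab_group_add \<Rightarrow> 'v) \<Rightarrow> ('v \<Rightarrow> 'v) \<Rightarrow> 'a poly multiset \<Rightarrow> bool" where
  "elementary_divisors scale \<sigma> E \<longleftrightarrow>
     (\<forall>d\<in>#E. \<exists>\<pi> k. irreducible \<pi> \<and> lead_coeff \<pi> = 1 \<and> k \<ge> 1 \<and> d = \<pi> ^ k) \<and>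
     (\<exists>ds vs. mset ds = E \<and> length vs = length ds \<and>
        (\<forall>v. \<exists>c. v = (\<Sum>i<length vs. poly_act scale \<sigma> (c i) (vs ! i))) \<and>
        (\<forall>c. (\<Sum>i<length vs. poly_act scale \<sigma> (c i) (vs ! i)) = 0
             \<longleftrightarrow> (\<forall>i<length vs. ds ! i dvd c i)))"


section \<open>The induced form on \<open>V/pV\<close>\<close>

definition quot_class ::
    "('a::field \<Rightarrow> 'v::ab_group_add \<Rightarrow> 'v) \<Rightarrow> ('v \<Rightarrow> 'v) \<Rightarrow> 'a poly \<Rightarrow> 'v \<Rightarrow> 'v set" where
  "quot_class scale \<sigma> p u = (\<lambda>w. u + w) ` range (poly_act scale \<sigma> p)"

definition quot_space ::
    "('a::field \<Rightarrow> 'v::ab_group_add \<Rightarrow> 'v) \<Rightarrow> ('v \<Rightarrow> 'v) \<Rightarrow> 'a poly \<Rightarrow> 'v set set" where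
  "quot_space scale \<sigma> p = range (quot_class scale \<sigma> p)"

text \<open>
  The value is well defined for \<open>A, B\<close> in \<open>V/pV\<close> when \<open>m \<ge> 1\<close>, \<open>p\<^sup>m\<close> annihilates \<open>V\<close>, \<open>f\<close>
  is bilinear with asymmetry \<open>\<sigma>\<close>, and \<open>p\<close> is \<open>X - 1\<close> or \<open>X + 1\<close>.
\<close>

definition form_hat ::
    "('a::field \<Rightarrow> 'v::ab_group_add \<Rightarrow> 'v) \<Rightarrow> ('v \<Rightarrow> 'v \<Rightarrow> 'a) \<Rightarrow> ('v \<Rightarrow> 'v) \<Rightarrow> 'a poly \<Rightarrow> nat
       \<Rightarrow> 'v set \<Rightarrow> 'v set \<Rightarrow> 'a" where
  "form_hat scale f \<sigma> p m A B =
     (THE c. \<exists>u v. A = quot_class scale \<sigma> p u \<and> B = quot_class scale \<sigma> p v \<and>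
                   c = f (poly_act scale \<sigma> (p ^ (m - 1)) u) v)"

end

theory Submission
  imports Defs
begin

text \<open>
  Write \<open>g(u, v) = f(p\<^sup>r\<^sup>-\<^sup>1 u, v)\<close>, a nonzero form. If \<open>g(u, u) \<noteq> 0\<close> for some \<open>u\<close>, let \<open>U\<close> be
  the cyclic submodule generated by \<open>u\<close>. If \<open>g\<close> is alternating, choose \<open>u, v\<close> with \<open>g(u, v) \<noteq> 0\<close>
  and let \<open>U\<close> be generated by \<open>u\<close> and \<open>v\<close>. In both cases the matrix of \<open>g\<close> on the generators is
  invertible. Up to a unit, \<open>p\<close> is self-adjoint for \<open>f\<close>, so comparing leading powers of \<open>p\<close> shows
  that the generators form an \<open>F[X]/(p\<^sup>r)\<close>-basis of \<open>U\<close> and that \<open>f\<close> is non-degenerate on \<open>U\<close>.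
  Hence \<open>V = U \<perp> U\<^sup>\<perp>\<close>, and \<open>V = U\<close> by indecomposability. A cyclic module whose annihilator is a
  power of \<open>p\<close> cannot be a direct sum of two nonzero submodules, so one and two elementary divisors
  exclude each other.
\<close>

section \<open>Bilinear forms with an asymmetry and the action of \<open>F[X]\<close>\<close>

locale asymmetric_form = finite_dimensional_vector_space scale Basis
  for scale :: "'a::field \<Rightarrow> 'v::ab_group_add \<Rightarrow> 'v" and Basis :: "'v set" +
  fixes f :: "'v \<Rightarrow> 'v \<Rightarrow> 'a" and \<sigma> :: "'v \<Rightarrow> 'v"
  assumes bilinear: "bilinear_form scale f"
    and asymmetry: "is_asymmetry scale f \<sigma>"
begin

abbreviation act :: "'a poly \<Rightarrow> 'v \<Rightarrow> 'v" where
  "act \<equiv> poly_act scale \<sigma>"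

text \<open>The \<open>F[X]\<close>-linear map from the free module on the positions of
  \<open>bs\<close>: its range is the submodule generated by \<open>bs\<close>, its kernel the
  module of relations. Values of \<open>a\<close> from \<open>length bs\<close> on are
  ignored.\<close>

definition comb :: "'v list \<Rightarrow> (nat \<Rightarrow> 'a poly) \<Rightarrow> 'v" where
  "comb bs a = (\<Sum>i<length bs. act (a i) (bs ! i))"

lemma linear_asymmetry: "Vector_Spaces.linear scale scale \<sigma>"
  using asymmetry by (simp add: is_asymmetry_def)

sublocale act: Modules.module "poly_act scale \<sigma>"
  by (rule module_poly_act[OF linear_asymmetry])

sublocale asym: Vector_Spaces.linear scale scale \<sigma>
  by (rule linear_asymmetry)

lemma form_swap: "f v u = f u (\<sigma> v)"
  using asymmetry by (simp add: is_asymmetry_def)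

text \<open>Two swaps:
  \<open>f u v = f v (\<sigma> u) = f (\<sigma> u) (\<sigma> v)\<close>.\<close>

lemma asymmetry_isometry: "f (\<sigma> u) (\<sigma> v) = f u v"
  by (metis form_swap)

lemma linear_left: "Vector_Spaces.linear scale (*) (\<lambda>u. f u v)"
  and linear_right: "Vector_Spaces.linear scale (*) (\<lambda>v. f u v)"
  using bilinear by (auto simp: bilinear_form_def)

lemma form_simps:
  "f (u + u') v = f u v + f u' v" "f (u - u') v = f u v - f u' v"
  "f (scale c u) v = c * f u v" "f 0 v = 0" "f (sum g S) v = (\<Sum>a\<in>S. f (g a) v)"
  "f v (u + u') = f v u + f v u'" "f v (u - u') = f v u - f v u'"
  "f v (scale c u) = c * f v u" "f v 0 = 0" "f v (sum g S) = (\<Sum>a\<in>S. f v (g a))"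
proof -
  interpret fl: Vector_Spaces.linear scale "(*)" "\<lambda>u. f u v" for v by (rule linear_left)
  interpret fr: Vector_Spaces.linear scale "(*)" "\<lambda>v. f u v" for u by (rule linear_right)
  show "f (u + u') v = f u v + f u' v" "f (u - u') v = f u v - f u' v"
    "f (scale c u) v = c * f u v" "f 0 v = 0" "f (sum g S) v = (\<Sum>a\<in>S. f (g a) v)"
    by (rule fl.add fl.diff fl.scale fl.zero fl.sum)+
  show "f v (u + u') = f v u + f v u'" "f v (u - u') = f v u - f v u'"
    "f v (scale c u) = c * f v u" "f v 0 = 0" "f v (sum g S) = (\<Sum>a\<in>S. f v (g a))"
    by (rule fr.add fr.diff fr.scale fr.zero fr.sum)+
qed

lemma act_const: "act [:c:] v = scale c v"
  by (simp add: poly_act_def)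

lemma act_X: "act [:0, 1:] v = \<sigma> v"
  by (simp add: poly_act_pCons[OF linear_asymmetry] act_const)

lemma act_linear_poly: "act [:c, 1:] v = \<sigma> v + scale c v"
  by (simp add: poly_act_pCons[OF linear_asymmetry] act_const add.commute)

lemma act_commute: "act q (act q' v) = act q' (act q v)"
  by (simp add: mult.commute)

lemma act_comb: "act q (comb bs a) = comb bs (\<lambda>i. q * a i)"
  by (simp add: comb_def act.scale_sum_right)

lemma range_comb_subspace: "subspace (range (comb bs))"
proof (rule subspaceI)
  have "0 = comb bs (\<lambda>_. 0)" by (simp add: comb_def)
  then show "0 \<in> range (comb bs)" by blast
next
  fix x y assume "x \<in> range (comb bs)" "y \<in> range (comb bs)"
  then obtain a b where "x = comb bs a" "y = comb bs b" by blast
  then have "x + y = comb bs (\<lambda>i. a i + b i)"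
    by (simp add: comb_def act.scale_left_distrib sum.distrib)
  then show "x + y \<in> range (comb bs)" by blast
next
  fix c x assume "x \<in> range (comb bs)"
  then obtain a where "x = comb bs a" by blast
  then have "scale c x = comb bs (\<lambda>i. [:c:] * a i)"
    by (metis act_comb act_const)
  then show "scale c x \<in> range (comb bs)" by blast
qed

lemma act_mem_range_comb:
  assumes "x \<in> range (comb bs)" shows "act q x \<in> range (comb bs)"
  using assms act_comb by auto

lemma nth_mem_range_comb:
  assumes "i < length bs" shows "bs ! i \<in> range (comb bs)"
proof -
  have "comb bs (\<lambda>j. if j = i then 1 else 0) =
      (\<Sum>j<length bs. if j = i then bs ! i else 0)"
    unfolding comb_def by (intro sum.cong) auto
  also have "\<dots> = bs ! i" using assms by simp
  finally show ?thesis by (metis rangeI)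
qed

section \<open>Splitting off a non-degenerate invariant subspace\<close>

text \<open>
  The endomorphism \<open>x \<mapsto> \<Sum> f(x, b) b\<close> of \<open>U\<close>, summed over a basis of \<open>U\<close>, replaces the map
  from \<open>U\<close> to its dual space.
\<close>
lemma nondegenerate_subspace_projection:
  assumes U: "subspace U"
    and nd: "\<And>x. x \<in> U \<Longrightarrow> (\<And>u. u \<in> U \<Longrightarrow> f x u = 0) \<Longrightarrow> x = 0"
  obtains u where "u \<in> U" "\<And>u'. u' \<in> U \<Longrightarrow> f (v - u) u' = 0"
proof -
  obtain B where B: "B \<subseteq> U" "independent B" "U \<subseteq> span B"
    using basis_exists by metis
  have finB: "finite B" using B(2) finiteI_independent by blast
  have "span B = U"
    by (metis B(1,3) U span_subspace)
  define \<phi> where "\<phi> x = (\<Sum>b\<in>B. scale (f x b) b)" for x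
  have lin: "Vector_Spaces.linear scale scale \<phi>"
    by unfold_locales
       (simp_all add: \<phi>_def form_simps scale_left_distrib sum.distrib scale_sum_right)
  have in_U: "\<phi> x \<in> U" for x
    unfolding \<phi>_def using B(1) U by (auto intro!: subspace_sum subspace_scale)
  have ker: "f x u = 0" if "\<phi> x = 0" "u \<in> U" for x u
  proof -
    have 0: "f x b = 0" if "b \<in> B" for b
      using independentD[OF B(2) finB subset_refl] \<open>\<phi> x = 0\<close> that unfolding \<phi>_def by blast
    have "u \<in> span B" using that B(3) by blast
    then show ?thesis
      by (induction rule: span_induct_alt) (auto simp: form_simps 0)
  qed
  interpret \<phi>: Vector_Spaces.linear scale scale \<phi> by (rule lin)
  have inj: "inj_on \<phi> U"
  proof (rule inj_onI)
    fix x y assume xy: "x \<in> U" "y \<in> U" "\<phi> x = \<phi> y"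
    then have "\<phi> (x - y) = 0" by (simp add: \<phi>.diff)
    moreover have "x - y \<in> U" using xy U subspace_diff by blast
    ultimately have "x - y = 0" using nd ker by blast
    then show "x = y" by simp
  qed
  interpret pair: finite_dimensional_vector_space_pair_1 scale Basis scale
    by unfold_locales
  have "dim (\<phi> ` U) = dim U"
    using pair.dim_image_eq[OF lin] inj U span_eq_iff by metis
  moreover have "subspace (\<phi> ` U)"
    using \<phi>.subspace_image U by blast
  ultimately have "\<phi> ` U = U"
    using subspace_dim_equal[of "\<phi> ` U" U] in_U U by auto
  then obtain u where "u \<in> U" "\<phi> v = \<phi> u" using in_U[of v] by blast
  then have "\<phi> (v - u) = 0" by (simp add: \<phi>.diff)
  then show thesis using that \<open>u \<in> U\<close> ker by blast
qed

text \<open>The projection lemma writes the space as the sum of \<open>U\<close> and its left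
  orthogonal complement \<open>W\<close>, and \<open>nd\<close> makes the sum direct. Since
  \<open>U\<close> is non-zero, indecomposability leaves \<open>W = {0}\<close>.\<close>

lemma indecomposable_invariant_eq_UNIV:
  assumes ind: "indecomposable scale f"
    and U: "subspace U" and inv: "\<And>u. u \<in> U \<Longrightarrow> \<sigma> u \<in> U"
    and nd: "\<And>x. x \<in> U \<Longrightarrow> (\<And>u. u \<in> U \<Longrightarrow> f x u = 0) \<Longrightarrow> x = 0"
    and nz: "U \<noteq> {0}"
  shows "U = UNIV"
proof -
  define W where "W = {x. \<forall>u\<in>U. f x u = 0}"
  have "subspace W"
    by (rule subspaceI) (auto simp: W_def form_simps)
  moreover have "U \<inter> W = {0}"
    using nd U subspace_0[OF U] by (auto simp: W_def form_simps)
  moreover have "{u1 + u2 | u1 u2. u1 \<in> U \<and> u2 \<in> W} = UNIV"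
  proof -
    have "\<exists>u1 u2. v = u1 + u2 \<and> u1 \<in> U \<and> u2 \<in> W" for v
    proof -
      obtain u where u: "u \<in> U" "\<And>u'. u' \<in> U \<Longrightarrow> f (v - u) u' = 0"
        using nondegenerate_subspace_projection[OF U nd, of v] by blast
      then have "v - u \<in> W" by (simp add: W_def)
      moreover have "v = u + (v - u)" by simp
      ultimately show ?thesis using u(1) by blast
    qed
    then show ?thesis by auto
  qed
  moreover have "\<forall>u1\<in>U. \<forall>u2\<in>W. f u1 u2 = 0 \<and> f u2 u1 = 0"
  proof (intro ballI conjI)
    fix u w assume "u \<in> U" "w \<in> W"
    then show "f w u = 0" by (simp add: W_def)
    \<comment> \<open>Membership in \<open>W\<close> is orthogonality on one side. Invariance gives
      the other side: \<open>f u w = f w (\<sigma> u)\<close> with \<open>\<sigma> u\<close> in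
      \<open>U\<close>.\<close>
    show "f u w = 0"
      using inv[OF \<open>u \<in> U\<close>] \<open>w \<in> W\<close> by (subst form_swap) (simp add: W_def)
  qed
  ultimately have "orthogonal_decomposition scale f U W"
    using U by (simp add: orthogonal_decomposition_def)
  then have "W = {0}" using ind nz unfolding indecomposable_def by blast
  have "v \<in> U" for v
  proof -
    obtain u where u: "u \<in> U" "\<And>u'. u' \<in> U \<Longrightarrow> f (v - u) u' = 0"
      using nondegenerate_subspace_projection[OF U nd, of v] by blast
    then have "v - u \<in> W" by (simp add: W_def)
    then show ?thesis using \<open>W = {0}\<close> u(1) by simp
  qed
  then show ?thesis by blast
qed

text \<open>Extend \<open>x\<close> to a basis: if \<open>f x\<close> vanished identically, the Gram
  matrix would have a zero row and could not be invertible.\<close>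

lemma nondegenerateD:
  assumes nd: "nondegenerate scale f" and x: "x \<noteq> 0"
  obtains v where "f x v \<noteq> 0"
proof -
  have "\<exists>v. f x v \<noteq> 0"
  proof (rule ccontr)
    assume "\<nexists>v. f x v \<noteq> 0"
    then have 0: "f x v = 0" for v by blast
    define B where "B = extend_basis {x}"
    have "independent {x}" using x by simp
    then have B: "{x} \<subseteq> B" "independent B" "span B = UNIV"
      unfolding B_def
      by (rule extend_basis_superset independent_extend_basis span_extend_basis)+
    then have "finite B" using finiteI_independent by blast
    then obtain bs where bs: "set bs = B" "distinct bs"
      using finite_distinct_list by blast
    then have "invertible_mat (gram_matrix f bs)"
      using nd B(2,3) unfolding nondegenerate_def by blast
    then obtain M where M: "inverts_mat (gram_matrix f bs) M" "inverts_mat M (gram_matrix f bs)"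
      unfolding invertible_mat_def by blast
    have G: "gram_matrix f bs \<in> carrier_mat (length bs) (length bs)"
      by (simp add: gram_matrix_def)
    have GM: "gram_matrix f bs * M = 1\<^sub>m (length bs)"
      using M(1) G by (simp add: inverts_mat_def)
    \<comment> \<open>\<open>invertible_mat\<close> gives \<open>M\<close> without its dimensions;
      they are read off from the two products.\<close>
    have "dim_row M = length bs"
      using M(2) G unfolding inverts_mat_def
      by (metis carrier_matD(2) index_mult_mat(3) index_one_mat(3))
    from GM have "dim_col M = length bs"
      by (metis index_mult_mat(3) index_one_mat(3))
    obtain i where i: "i < length bs" "bs ! i = x"
      using B(1) bs(1) by (metis in_set_conv_nth insert_subset)
    have "(gram_matrix f bs * M) $$ (i, i) = 0"
      using i G \<open>dim_col M = length bs\<close> \<open>dim_row M = length bs\<close> 0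
      by (simp add: gram_matrix_def scalar_prod_def)
    then show False using GM i by simp
  qed
  then show thesis using that by blast
qed

end

section \<open>Asymmetries killed by a power of \<open>X - \<epsilon>\<close> with
  \<open>\<epsilon>\<close> equal to 1 or -1\<close>

text \<open>The equation \<open>\<epsilon> * \<epsilon> = 1\<close> treats both choices of
  \<open>p\<close> at once. Minimality of \<open>r\<close> enters later through a vector that
  \<open>p ^ (r - 1)\<close> does not kill.\<close>

locale unipotent_form = asymmetric_form scale Basis f \<sigma>
  for scale :: "'a::field \<Rightarrow> 'v::ab_group_add \<Rightarrow> 'v" and Basis f \<sigma> +
  fixes \<epsilon> :: 'a and p :: "'a poly" and r :: nat
  assumes eps: "\<epsilon> * \<epsilon> = 1" and p_eq: "p = [:-\<epsilon>, 1:]"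
    and r: "r \<ge> 1" and annihilates: "\<And>v. poly_act scale \<sigma> (p ^ r) v = 0"
begin

lemma act_p: "act p v = \<sigma> v - scale \<epsilon> v"
  by (simp add: p_eq act_linear_poly)

text \<open>Self-adjointness of \<open>p\<close> up to the unit \<open>- \<epsilon> X\<close>: since
  \<sigma> is an isometry, its adjoint is its inverse, and
  \<open>\<epsilon> * \<epsilon> = 1\<close> turns \<open>1 / X - \<epsilon>\<close> into
  \<open>- \<epsilon> (X - \<epsilon>) / X\<close>.\<close>

lemma form_act_p: "f x (act p w) = - \<epsilon> * f (act p x) (\<sigma> w)"
proof -
  have "- \<epsilon> * f (act p x) (\<sigma> w) = - \<epsilon> * f x w + (\<epsilon> * \<epsilon>) * f x (\<sigma> w)"
    by (simp add: act_p form_simps asymmetry_isometry algebra_simps)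
  then show ?thesis using eps by (simp add: act_p form_simps)
qed

lemma form_act_p_power:
  "f x (act (p ^ j) w) = (- \<epsilon>) ^ j * f (act (p ^ j) x) (act ([:0, 1:] ^ j) w)"
proof (induction j arbitrary: w)
  case 0
  then show ?case by simp
next
  case (Suc j)
  have "f x (act (p ^ Suc j) w) = f x (act (p ^ j) (act p w))"
    by (simp add: mult.commute)
  also have "\<dots> = (- \<epsilon>) ^ j * f (act (p ^ j) x) (act p (act ([:0, 1:] ^ j) w))"
    by (subst Suc) (simp add: mult.commute)
  also have "\<dots> = (- \<epsilon>) ^ Suc j * f (act p (act (p ^ j) x)) (\<sigma> (act ([:0, 1:] ^ j) w))"
    by (subst form_act_p) simp
  also have "\<sigma> (act ([:0, 1:] ^ j) w) = act ([:0, 1:] ^ Suc j) w"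
    by (simp add: act_X [symmetric])
  finally show ?case by simp
qed

lemma form_asymmetry_right:
  assumes "act p z = 0" shows "f z (\<sigma> w) = \<epsilon> * f z w"
proof -
  have "f z (act p w) = 0" by (subst form_act_p) (simp add: assms form_simps)
  then show ?thesis by (simp add: act_p form_simps)
qed

lemma form_X_power_right:
  assumes "act p z = 0" shows "f z (act ([:0, 1:] ^ j) w) = \<epsilon> ^ j * f z w"
proof (induction j)
  case (Suc j)
  have "act ([:0, 1:] ^ Suc j) w = \<sigma> (act ([:0, 1:] ^ j) w)"
    by (simp add: act_X [symmetric])
  then show ?case using Suc form_asymmetry_right[OF assms] by simp
qed simp

lemma act_p_pred_power: "act p (act (p ^ (r - 1)) v) = 0"
proof -
  have "p ^ r = p * p ^ (r - 1)" using r by (cases r) auto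
  then show ?thesis using annihilates[of v] by simp
qed

text \<open>The image of \<open>p ^ (r - 1)\<close> is killed by \<open>p\<close>, so
  \<open>q\<close> acts on it through its remainder modulo \<open>X - \<epsilon>\<close>, the
  constant \<open>poly q \<epsilon>\<close>.\<close>

lemma act_pred_power:
  "act q (act (p ^ (r - 1)) v) = scale (poly q \<epsilon>) (act (p ^ (r - 1)) v)"
proof -
  have "p dvd q - [:poly q \<epsilon>:]"
    by (simp add: p_eq poly_eq_0_iff_dvd [symmetric])
  then obtain s where "q = [:poly q \<epsilon>:] + s * p"
    by (metis dvdE mult.commute diff_eq_eq add.commute)
  then have "act q (act (p ^ (r - 1)) v) =
      act ([:poly q \<epsilon>:] + s * p) (act (p ^ (r - 1)) v)" by simp
  also have "\<dots> = scale (poly q \<epsilon>) (act (p ^ (r - 1)) v) + act s (act p (act (p ^ (r - 1)) v))"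
    by (simp only: act.scale_left_distrib act_const flip: act.scale_scale)
  finally show ?thesis by (simp only: act_p_pred_power act.scale_zero_right add_0_right)
qed

text \<open>This is the form on \<open>V\<close> from which the form on \<open>V/pV\<close> is induced.\<close>
definition top_form :: "'v \<Rightarrow> 'v \<Rightarrow> 'a" where
  "top_form u v = f (act (p ^ (r - 1)) u) v"

lemma top_form_add_left: "top_form (u + v) w = top_form u w + top_form v w"
  and top_form_add_right: "top_form w (u + v) = top_form w u + top_form w v"
  by (simp_all add: top_form_def form_simps act.scale_right_distrib)

lemma top_form_act_left: "top_form (act q u) v = poly q \<epsilon> * top_form u v"
  using act_commute[of "p ^ (r - 1)" q u]
  by (simp only: top_form_def act_pred_power form_simps)

text \<open>This and its right-hand counterpart let \<open>top_form\<close> descend to the quotient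
  by the image of \<open>p\<close>.\<close>

lemma top_form_act_p_left: "top_form (act p u) v = 0"
  by (subst top_form_act_left) (simp add: p_eq)

lemma top_form_act_p_right: "top_form u (act p v) = 0"
  unfolding top_form_def by (subst form_act_p) (simp only: act_p_pred_power form_simps mult_zero_right)

section \<open>Bases from families with nonsingular top form\<close>

text \<open>Invertibility of the Gram matrix of \<open>top_form\<close> on \<open>bs\<close>,
  phrased as triviality of its left kernel so that values \<open>poly (b i) \<epsilon>\<close> can
  serve as \<open>c i\<close>.\<close>

definition top_nonsingular :: "'v list \<Rightarrow> bool" where
  "top_nonsingular bs \<longleftrightarrow> (\<forall>c.
     (\<forall>j<length bs. (\<Sum>i<length bs. c i * top_form (bs ! i) (bs ! j)) = 0) \<longrightarrow>
     (\<forall>i<length bs. c i = 0))"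

text \<open>Powers of \<open>p\<close> are extracted one at a time. Once \<open>p ^ k\<close> with
  \<open>k < r\<close> divides all coefficients, suitable test vectors show that the values of the
  cofactors at \<epsilon> lie in the left kernel of the Gram matrix, so \<open>p\<close> divides the
  cofactors as well.\<close>

lemma orthogonal_imp_dvd:
  assumes nd: "top_nonsingular bs"
    and orth: "\<And>w. w \<in> range (comb bs) \<Longrightarrow> f (comb bs a) w = 0"
    and i: "i < length bs"
  shows "p ^ r dvd a i"
proof -
  have "\<forall>i<length bs. p ^ k dvd a i" if "k \<le> r" for k
    using that
  proof (induction k)
    case 0
    then show ?case by simp
  next
    case (Suc k)
    then have k: "k < r" and "\<forall>i. \<exists>b. i < length bs \<longrightarrow> a i = p ^ k * b"
      by (auto simp: dvd_def)
    then obtain b where b: "\<And>i. i < length bs \<Longrightarrow> a i = p ^ k * b i" by metis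
    define y where "y = comb bs b"
    have x: "comb bs a = act (p ^ k) y"
      unfolding y_def act_comb unfolding comb_def by (intro sum.cong) (auto simp: b)
    \<comment> \<open>The exponent that lifts \<open>p ^ k\<close> to \<open>p ^ (r - 1)\<close>,
      the last power whose image \<open>p\<close> kills.\<close>
    define l where "l = r - 1 - k"
    have pl: "act (p ^ l) (comb bs a) = act (p ^ (r - 1)) y"
      using k by (simp add: x l_def flip: power_add)
    have "(\<Sum>i<length bs. poly (b i) \<epsilon> * top_form (bs ! i) (bs ! j)) = 0"
      if j: "j < length bs" for j
    proof -
      \<comment> \<open>Moving \<open>p ^ l\<close> from the test vector to the left produces
        \<open>top_form\<close>; the factor \<open>X ^ l\<close> left behind acts as the non-zero
        scalar \<open>\<epsilon> ^ l\<close>.\<close>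
      have "0 = f (comb bs a) (act (p ^ l) (bs ! j))"
        using orth act_mem_range_comb nth_mem_range_comb j by metis
      also have "\<dots> = (- \<epsilon>) ^ l * f (act (p ^ (r - 1)) y) (act ([:0, 1:] ^ l) (bs ! j))"
        by (subst form_act_p_power) (simp only: pl)
      also have "\<dots> = (- \<epsilon>) ^ l * (\<epsilon> ^ l * top_form y (bs ! j))"
        by (subst form_X_power_right) (simp_all only: act_p_pred_power top_form_def)
      finally have "top_form y (bs ! j) = 0" using eps by auto
      moreover have "top_form y (bs ! j) = (\<Sum>i<length bs. top_form (act (b i) (bs ! i)) (bs ! j))"
        by (simp only: y_def top_form_def comb_def act.scale_sum_right form_simps)
      ultimately show ?thesis by (simp add: top_form_act_left)
    qed
    then have "poly (b i) \<epsilon> = 0" if "i < length bs" for i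
      using nd that unfolding top_nonsingular_def
      by (elim allE[of _ "\<lambda>i. poly (b i) \<epsilon>"]) blast
    then have "p dvd b i" if "i < length bs" for i
      using that by (simp add: p_eq poly_eq_0_iff_dvd)
    then show ?case using b by (auto simp: mult.commute intro!: mult_dvd_mono)
  qed
  then show ?thesis using i by blast
qed

text \<open>\<open>orthogonal_imp_dvd\<close> serves twice: a vanishing combination is orthogonal to
  everything, which gives the relations, and a vector of the range orthogonal to the range is zero,
  which gives non-degeneracy there.\<close>

lemma nondegenerate_family_basis:
  assumes ind: "indecomposable scale f"
    and nd: "top_nonsingular bs"
    and nz: "\<exists>b\<in>set bs. b \<noteq> 0"
  shows "range (comb bs) = UNIV"
    and "comb bs a = 0 \<longleftrightarrow> (\<forall>i<length bs. p ^ r dvd a i)"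
proof -
  have zero: "comb bs a = 0" if "\<forall>i<length bs. p ^ r dvd a i" for a
    unfolding comb_def
  proof (rule sum.neutral, intro ballI)
    fix i assume "i \<in> {..<length bs}"
    then have "p ^ r dvd a i" using that by blast
    then obtain q where "a i = q * p ^ r" by (metis dvdE mult.commute)
    then have "act (a i) (bs ! i) = act q (act (p ^ r) (bs ! i))" by simp
    then show "act (a i) (bs ! i) = 0" by (simp only: annihilates act.scale_zero_right)
  qed
  show "comb bs a = 0 \<longleftrightarrow> (\<forall>i<length bs. p ^ r dvd a i)"
  proof
    assume "comb bs a = 0"
    then have "f (comb bs a) w = 0" for w by (simp add: form_simps)
    then show "\<forall>i<length bs. p ^ r dvd a i"
      using orthogonal_imp_dvd[OF nd] by blast
  qed (rule zero)
  show "range (comb bs) = UNIV"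
  proof (rule indecomposable_invariant_eq_UNIV[OF ind range_comb_subspace])
    show "\<sigma> u \<in> range (comb bs)" if "u \<in> range (comb bs)" for u
      using act_mem_range_comb[OF that, of "[:0, 1:]"] by (simp only: act_X)
    show "range (comb bs) \<noteq> {0}"
      using nz nth_mem_range_comb by (metis in_set_conv_nth singletonD)
    fix x assume x: "x \<in> range (comb bs)" "\<And>u. u \<in> range (comb bs) \<Longrightarrow> f x u = 0"
    then obtain a where a: "x = comb bs a" by blast
    then have "\<forall>i<length bs. p ^ r dvd a i"
      using orthogonal_imp_dvd[OF nd] x(2) by blast
    then show "x = 0" using zero a by simp
  qed
qed

section \<open>Freeness and elementary divisors\<close>

lemma irreducible_p: "irreducible p"
  by (simp add: p_eq irreducible_linear_field_poly)

lemma power_p_dvd_iff: "p ^ k dvd p ^ l \<longleftrightarrow> k \<le> l"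
  using irreducible_p by (simp add: irreducible_def dvd_power_iff)

lemma basis_imp_elementary_divisors:
  assumes "range (comb bs) = UNIV"
    and "\<And>a. comb bs a = 0 \<longleftrightarrow> (\<forall>i<length bs. p ^ r dvd a i)"
  shows "elementary_divisors scale \<sigma> (replicate_mset (length bs) (p ^ r))"
  unfolding elementary_divisors_def comb_def [symmetric]
proof (intro conjI ballI)
  fix d assume "d \<in># replicate_mset (length bs) (p ^ r)"
  then have "d = p ^ r" by (simp split: if_splits)
  then show "\<exists>\<pi> k. irreducible \<pi> \<and> lead_coeff \<pi> = 1 \<and> k \<ge> 1 \<and> d = \<pi> ^ k"
    using irreducible_p r by (intro exI[of _ p] exI[of _ r]) (simp add: p_eq)
next
  show "\<exists>ds vs. mset ds = replicate_mset (length bs) (p ^ r) \<and> length vs = length ds \<and>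
      (\<forall>v. \<exists>c. v = comb vs c) \<and> (\<forall>c. comb vs c = 0 \<longleftrightarrow> (\<forall>i<length vs. ds ! i dvd c i))"
  proof (intro exI[of _ "replicate (length bs) (p ^ r)"] exI[of _ bs] conjI allI)
    show "\<exists>c. v = comb bs c" for v using assms(1) by (metis UNIV_I imageE)
  qed (use assms(2) in simp_all)
qed

lemma basis_imp_free:
  assumes "range (comb bs) = UNIV"
    and rel: "\<And>a. comb bs a = 0 \<longleftrightarrow> (\<forall>i<length bs. p ^ r dvd a i)"
  shows "free_quotient_module scale \<sigma> (p ^ r)"
  unfolding free_quotient_module_def
proof (intro conjI allI exI[of _ "set bs"])
  show "act (p ^ r) v = 0" for v by (rule annihilates)
  have "comb bs a \<in> act.span (set bs)" for a
    unfolding comb_def by (intro act.span_sum act.span_scale act.span_base) auto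
  then have "range (comb bs) \<subseteq> act.span (set bs)" by (rule image_subsetI)
  then show "act.span (set bs) = UNIV" unfolding assms(1) by (rule top_le)
  have not1: "\<not> p ^ r dvd 1"
    using power_p_dvd_iff[of r 0] r by simp
  \<comment> \<open>Freeness speaks of a set of generators, so repetitions in \<open>bs\<close> must
    be excluded: equal entries at \<open>i\<close> and \<open>j\<close> give a relation with
    coefficients 1 and -1, forcing \<open>p ^ r\<close> to divide 1.\<close>
  have dist: "distinct bs"
  proof (rule ccontr)
    assume "\<not> distinct bs"
    then obtain i j where ij: "i < length bs" "j < length bs" "i \<noteq> j" "bs ! i = bs ! j"
      by (auto simp: distinct_conv_nth)
    define a :: "nat \<Rightarrow> 'a poly" where "a = (\<lambda>k. (if k = i then 1 else 0) - (if k = j then 1 else 0))"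
    have "comb bs a = (\<Sum>k<length bs. (if k = i then bs ! i else 0) - (if k = j then bs ! j else 0))"
      unfolding comb_def by (intro sum.cong) (auto simp: a_def act.scale_left_diff_distrib)
    also have "\<dots> = 0" using ij by (simp add: sum_subtractf)
    finally have "p ^ r dvd a i" using rel ij by blast
    then show False using ij(3) not1 by (simp add: a_def)
  qed
  fix S c
  show "finite S \<and> S \<subseteq> set bs \<and> (\<Sum>b\<in>S. act (c b) b) = 0 \<longrightarrow> (\<forall>b\<in>S. p ^ r dvd c b)"
  proof (intro impI ballI)
    fix b assume S: "finite S \<and> S \<subseteq> set bs \<and> (\<Sum>b\<in>S. act (c b) b) = 0" and b: "b \<in> S"
    define c' where "c' b = (if b \<in> S then c b else 0)" for b
    have "comb bs (\<lambda>i. c' (bs ! i)) = (\<Sum>b\<in>set bs. act (c' b) b)"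
      unfolding comb_def using bij_betw_nth[OF dist refl refl]
      by (intro sum.reindex_bij_betw) 
    also have "\<dots> = (\<Sum>b\<in>S. act (c' b) b)"
      using S by (intro sum.mono_neutral_right) (auto simp: c'_def)
    also have "\<dots> = (\<Sum>b\<in>S. act (c b) b)" by (simp add: c'_def)
    finally have 0: "comb bs (\<lambda>i. c' (bs ! i)) = 0" using S by simp
    have "b \<in> set bs" using S b by blast
    then obtain i where i: "i < length bs" "bs ! i = b" by (auto simp: in_set_conv_nth)
    have "\<forall>i<length bs. p ^ r dvd c' (bs ! i)" using 0 by (rule rel[THEN iffD1])
    then have "p ^ r dvd c' b" using i by blast
    then show "p ^ r dvd c b" using b by (simp add: c'_def)
  qed
qed

text \<open>One divisor makes the module cyclic, generated by \<open>w\<close>. Two generators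
  \<open>c0 w\<close> and \<open>c1 w\<close> satisfy an obvious relation that forces
  \<open>p\<close> to divide \<open>c0\<close> and \<open>c1\<close>; then \<open>w\<close> is a
  \<open>p\<close>-multiple of itself and nilpotency of \<open>p\<close> gives
  \<open>w = 0\<close>.\<close>

lemma elementary_divisors_not_one_and_two:
  assumes "elementary_divisors scale \<sigma> E" "size E = 1"
    and "elementary_divisors scale \<sigma> E'" "size E' = 2"
  shows False
proof -
  obtain ds vs where "mset ds = E" "length vs = length ds" and gen: "\<And>v. \<exists>c. v = comb vs c"
    using assms(1) unfolding elementary_divisors_def comb_def [symmetric] by blast
  then have "length vs = 1" using assms(2) by (metis size_mset)
  then obtain w where "vs = [w]" by (metis One_nat_def length_0_conv length_Suc_conv)
  then have w: "\<exists>c. v = act c w" for v using gen[of v] by (auto simp: comb_def)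
  obtain ds' vs' where E': "mset ds' = E'" "length vs' = length ds'"
    and gen': "\<And>v. \<exists>c. v = comb vs' c"
    and rel': "\<And>c. comb vs' c = 0 \<longleftrightarrow> (\<forall>i<length vs'. ds' ! i dvd c i)"
    using assms(3) unfolding elementary_divisors_def comb_def [symmetric] by blast
  then have len: "length vs' = 2" using assms(4) by (metis size_mset)
  have sum2: "comb vs' c = act (c 0) (vs' ! 0) + act (c 1) (vs' ! 1)" for c
    by (simp add: comb_def len numeral_2_eq_2)
  \<comment> \<open>As \<open>p ^ r\<close> annihilates the module, each divisor divides
    \<open>p ^ r\<close>, so its irreducible base is associated to \<open>p\<close>.\<close>
  have p_dvd: "p dvd ds' ! i" if i: "i < 2" for i
  proof -
    have "comb vs' (\<lambda>_. p ^ r) = 0" by (simp only: comb_def annihilates sum.neutral_const)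
    then have dvd: "ds' ! i dvd p ^ r" using rel' i len by simp
    have "ds' ! i \<in># E'" using E' len i by (metis nth_mem set_mset_mset)
    then obtain \<pi> k where \<pi>: "irreducible \<pi>" "k \<ge> 1" "ds' ! i = \<pi> ^ k"
      using assms(3) unfolding elementary_divisors_def by blast
    then have "\<pi> dvd ds' ! i" by (simp add: dvd_power)
    then have "\<pi> dvd p ^ r" using dvd dvd_trans by blast
    then have "\<pi> dvd p" using \<pi>(1) by (metis field_poly_irreducible_imp_prime prime_elem_dvd_power)
    then have "p dvd \<pi>"
      using irreducible_p \<pi>(1) by (meson irreducibleD' irreducible_def)
    then show ?thesis using \<open>\<pi> dvd ds' ! i\<close> dvd_trans by blast
  qed
  obtain c0 c1 where c: "vs' ! 0 = act c0 w" "vs' ! 1 = act c1 w" using w by metis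
  \<comment> \<open>The relation \<open>c1 (c0 w) - c0 (c1 w) = 0\<close>.\<close>
  define a where "a i = (if i = 0 then c1 else - c0)" for i :: nat
  have "comb vs' a = 0"
    by (simp only: sum2 c) (simp add: a_def mult.commute)
  then have a_dvd: "ds' ! i dvd a i" if "i < 2" for i
    using that rel' len by simp
  have "ds' ! 0 dvd c1" "ds' ! 1 dvd c0"
    using a_dvd[of 0] a_dvd[of 1] by (simp_all add: a_def)
  then have "p dvd c0" "p dvd c1" using p_dvd[of 0] p_dvd[of 1] dvd_trans by auto
  then obtain q0 q1 where q: "c0 = p * q0" "c1 = p * q1" by (auto simp: dvd_def)
  obtain d where "w = comb vs' d" using gen' by blast
  then have "w = act (d 0 * c0 + d 1 * c1) w"
    by (simp only: sum2 c act.scale_left_distrib act.scale_scale)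
  then have "w = act (p * (d 0 * q0 + d 1 * q1)) w"
    by (simp add: q algebra_simps)
  then obtain s t where t: "t = p * s" "act t w = w" by metis
  \<comment> \<open>For \<open>n = r\<close> the power \<open>t ^ r = s ^ r * p ^ r\<close> both
    fixes and kills \<open>w\<close>.\<close>
  have "act (t ^ n) w = w" for n
    by (induction n) (simp_all only: power_0 power_Suc act.scale_one t(2) flip: act.scale_scale)
  then have "w = act (s ^ r) (act (p ^ r) w)"
    by (metis act.scale_scale mult.commute power_mult_distrib t(1))
  then have "w = 0" by (simp add: annihilates)
  then have "comb vs' (\<lambda>_. 1) = 0" by (simp only: sum2 c) simp
  then have "ds' ! 0 dvd 1" using rel' len by simp
  then have "p dvd 1" using p_dvd[of 0] dvd_trans by auto
  then show False using irreducible_p by (simp add: irreducible_def)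
qed

section \<open>The induced form and the choice of generators\<close>

text \<open>The definite description is resolved because representatives of one class differ by an
  element of the image of \<open>p\<close>, where \<open>top_form\<close> vanishes.\<close>

lemma form_hat_quot_class:
  "form_hat scale f \<sigma> p r (quot_class scale \<sigma> p u) (quot_class scale \<sigma> p v) = top_form u v"
proof -
  have eq: "\<exists>x. u' = u + act p x"
    if "quot_class scale \<sigma> p u = quot_class scale \<sigma> p u'" for u u'
  proof -
    have "u' = u' + act p 0" by simp
    then have "u' \<in> quot_class scale \<sigma> p u'" unfolding quot_class_def by blast
    then show ?thesis using that unfolding quot_class_def by blast
  qed
  show ?thesis
    unfolding form_hat_def
  proof (rule the_equality)
    fix c
    assume "\<exists>u' v'. quot_class scale \<sigma> p u = quot_class scale \<sigma> p u' \<and>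
      quot_class scale \<sigma> p v = quot_class scale \<sigma> p v' \<and> c = f (act (p ^ (r - 1)) u') v'"
    then obtain u' v' where uv: "quot_class scale \<sigma> p u = quot_class scale \<sigma> p u'"
      "quot_class scale \<sigma> p v = quot_class scale \<sigma> p v'" "c = top_form u' v'"
      by (auto simp: top_form_def)
    obtain x y where "u' = u + act p x" "v' = v + act p y"
      using eq[OF uv(1)] eq[OF uv(2)] by blast
    then show "c = top_form u v"
      by (simp add: uv(3) top_form_add_left top_form_add_right
          top_form_act_p_left top_form_act_p_right)
  qed (auto simp: top_form_def)
qed

lemma alternating_form_hat_iff:
  "alternating_on (quot_space scale \<sigma> p) (form_hat scale f \<sigma> p r) \<longleftrightarrow> (\<forall>u. top_form u u = 0)"
  by (auto simp: alternating_on_def quot_space_def form_hat_quot_class)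

lemma basis_exists_by_top_form:
  assumes ind: "indecomposable scale f" and nondeg: "nondegenerate scale f"
    and min: "act (p ^ (r - 1)) u0 \<noteq> 0"
  obtains bs where "length bs = (if \<forall>u. top_form u u = 0 then 2 else 1)"
    "range (comb bs) = UNIV" "\<And>a. comb bs a = 0 \<longleftrightarrow> (\<forall>i<length bs. p ^ r dvd a i)"
proof (cases "\<forall>u. top_form u u = 0")
  case False
  then obtain u where u: "top_form u u \<noteq> 0" by blast
  then have "u \<noteq> 0" by (auto simp: top_form_def form_simps)
  have "top_nonsingular [u]" using u by (simp add: top_nonsingular_def)
  note basis = nondegenerate_family_basis[OF ind this]
  show thesis
    by (rule that[of "[u]"]) (use False basis \<open>u \<noteq> 0\<close> in auto)
next
  case True
  obtain v0 where v0: "top_form u0 v0 \<noteq> 0"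
    using nondegenerateD[OF nondeg min] by (auto simp: top_form_def)
  \<comment> \<open>Polarization: an alternating form is antisymmetric, in every
    characteristic.\<close>
  have anti: "top_form v0 u0 = - top_form u0 v0"
  proof -
    have "top_form (u0 + v0) (u0 + v0) = top_form u0 v0 + top_form v0 u0"
      using True[rule_format, of u0] True[rule_format, of v0]
      by (simp add: top_form_add_left top_form_add_right)
    then have "top_form u0 v0 + top_form v0 u0 = 0" using True by simp
    then show ?thesis by (simp add: eq_neg_iff_add_eq_0 add.commute)
  qed
  have "u0 \<noteq> 0" using min by auto
  let ?bs = "[u0, v0]"
  have "top_nonsingular ?bs"
    unfolding top_nonsingular_def
  proof (intro allI impI)
    fix c i
    assume h: "\<forall>j<length ?bs. (\<Sum>i<length ?bs. c i * top_form (?bs ! i) (?bs ! j)) = 0"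
      and i: "i < length ?bs"
    \<comment> \<open>The Gram matrix has zero diagonal and off-diagonal entries
      \<open>top_form u0 v0\<close> and its negative, so each column isolates one
      coefficient.\<close>
    have "c 0 = 0" using h[rule_format, of 1] True v0 by simp
    moreover have "c 1 = 0" using h[rule_format, of 0] True v0 anti by simp
    ultimately show "c i = 0" using i by (auto simp: less_Suc_eq)
  qed
  note basis = nondegenerate_family_basis[OF ind this]
  show thesis
    by (rule that[of ?bs]) (use True basis \<open>u0 \<noteq> 0\<close> in auto)
qed

text \<open>Pins down the exponent in the theorem, so that \<open>form_hat\<close> at
  \<open>m\<close> is the one computed at \<open>r\<close>. Annihilation by \<open>p ^ m\<close>
  gives \<open>r \<le> m\<close>; a basis element killed by \<open>p ^ r\<close> gives
  \<open>m \<le> r\<close>.\<close>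

lemma free_quotient_module_exponent:
  assumes "act (p ^ (r - 1)) u0 \<noteq> 0" "free_quotient_module scale \<sigma> (p ^ m)"
  shows "m = r"
proof (rule antisym)
  have ann: "act (p ^ m) v = 0" for v
    using assms(2) by (simp add: free_quotient_module_def)
  show "r \<le> m"
  proof (rule ccontr)
    assume "\<not> r \<le> m"
    then have "p ^ (r - 1) = p ^ (r - 1 - m) * p ^ m" by (simp flip: power_add)
    then have "act (p ^ (r - 1)) u0 = act (p ^ (r - 1 - m)) (act (p ^ m) u0)" by simp
    then show False using assms(1) by (simp add: ann)
  qed
  obtain B where B: "act.span B = UNIV"
    "\<forall>S c. finite S \<and> S \<subseteq> B \<and> (\<Sum>b\<in>S. act (c b) b) = 0 \<longrightarrow> (\<forall>b\<in>S. p ^ m dvd c b)"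
    using assms(2) unfolding free_quotient_module_def
    by (elim conjE exE) (rule that)
  have "B \<noteq> {}"
  proof
    assume "B = {}"
    then have "u0 = 0" using B(1) by auto
    then show False using assms(1) by simp
  qed
  then obtain b where "b \<in> B" by blast
  then have "p ^ m dvd p ^ r"
    using B(2)[rule_format, of "{b}" "\<lambda>_. p ^ r" b] annihilates by simp
  then show "m \<le> r" by (simp add: power_p_dvd_iff)
qed

end

theorem lemma5p2:
  fixes scale :: "'a::field \<Rightarrow> 'v::ab_group_add \<Rightarrow> 'v"
    and Basis :: "'v set"
    and f :: "'v \<Rightarrow> 'v \<Rightarrow> 'a"
    and \<sigma> :: "'v \<Rightarrow> 'v"
    and p :: "'a poly"
    and r :: nat
  assumes fin_dim: "finite_dimensional_vector_space scale Basis"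
    and nonzero: "\<exists>v::'v. v \<noteq> 0"
    and bilinear: "bilinear_form scale f"
    and nondegenerate: "nondegenerate scale f"
    and asymmetry: "is_asymmetry scale f \<sigma>"
    and p: "p = [:-1, 1:] \<or> p = [:1, 1:]"
    and r: "r \<ge> 1"
    and minimal_polynomial: "is_minimal_polynomial scale \<sigma> (p ^ r)"
    and indecomposable: "indecomposable scale f"
  shows "(\<exists>m\<ge>1. free_quotient_module scale \<sigma> (p ^ m)) \<and>
    (\<forall>m\<ge>1. free_quotient_module scale \<sigma> (p ^ m) \<longrightarrow>
       ((\<exists>E. elementary_divisors scale \<sigma> E \<and> size E = 1)
          \<longleftrightarrow> \<not> alternating_on (quot_space scale \<sigma> p)
                  (form_hat scale f \<sigma> p m)) \<and>
       ((\<exists>E. elementary_divisors scale \<sigma> E \<and> size E = 2)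
          \<longleftrightarrow> alternating_on (quot_space scale \<sigma> p)
                  (form_hat scale f \<sigma> p m)))"
proof -
  obtain \<epsilon> :: 'a where eps: "\<epsilon> * \<epsilon> = 1" "p = [:-\<epsilon>, 1:]"
  proof (rule disjE[OF p])
    assume "p = [:-1, 1:]"
    then show thesis by (intro that[of 1]) auto
  next
    assume "p = [:1, 1:]"
    then show thesis by (intro that[of "-1"]) auto
  qed
  interpret finite_dimensional_vector_space scale Basis by (rule fin_dim)
  interpret unipotent_form scale Basis f \<sigma> \<epsilon> p r
    using bilinear asymmetry eps r minimal_polynomial
    by unfold_locales (auto simp: is_minimal_polynomial_def)
  have "\<not> p ^ r dvd p ^ (r - 1)" using r by (simp add: power_p_dvd_iff)
  \<comment> \<open>Otherwise \<open>p ^ (r - 1)\<close> would kill the space and be divisible by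
    the minimal polynomial \<open>p ^ r\<close>.\<close>
  then obtain u0 where u0: "act (p ^ (r - 1)) u0 \<noteq> 0"
    using minimal_polynomial unfolding is_minimal_polynomial_def by blast
  obtain bs where bs: "length bs = (if \<forall>u. top_form u u = 0 then 2 else 1)"
    "range (comb bs) = UNIV" "\<And>a. comb bs a = 0 \<longleftrightarrow> (\<forall>i<length bs. p ^ r dvd a i)"
    using basis_exists_by_top_form[OF indecomposable nondegenerate u0] by blast
  have "free_quotient_module scale \<sigma> (p ^ r)"
    using basis_imp_free[OF bs(2,3)] .
  moreover have "elementary_divisors scale \<sigma> (replicate_mset (length bs) (p ^ r))"
    using basis_imp_elementary_divisors[OF bs(2,3)] .
  then have "\<exists>E. elementary_divisors scale \<sigma> E \<and> size E = (if \<forall>u. top_form u u = 0 then 2 else 1)"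
    using bs(1) by (metis size_replicate_mset)
  \<comment> \<open>The constructed basis realizes one of the sizes 1 and 2; mutual exclusion turns
    both implications into equivalences.\<close>
  then have "(\<exists>E. elementary_divisors scale \<sigma> E \<and> size E = 1) \<longleftrightarrow> \<not> (\<forall>u. top_form u u = 0)"
    "(\<exists>E. elementary_divisors scale \<sigma> E \<and> size E = 2) \<longleftrightarrow> (\<forall>u. top_form u u = 0)"
    using elementary_divisors_not_one_and_two by (auto split: if_splits)
  ultimately show ?thesis
    using r free_quotient_module_exponent[OF u0] alternating_form_hat_iff by metis
qed

end
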